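(* Let $D=\{(x,y)\in\mathbb{R}^2 : x^2+y^2\le 1\}$. For each $\mu\in D$, let $U$ be a random point uniformly distributed in $D$ (with respect to area), let $X$ be the shadow cast by $U$ on the boundary circle of $D$ when the light source is at $\mu$, and let $E_\mu$ denote expectation in this situation. Then $E_\mu(X)=-\mu/2$ for every $\mu\in D$. Consequently, for a real constant $c$, the estimator $cX$ of $\mu$ is unbiased, i.e. $E_\mu(cX)=\mu$ for all $\mu\in D$, if and only if $c=-2$; and the resulting unbiased estimator $-2X$ always lies outside $D$, at distance exactly $1$ (a full radius) from $D$.
   Context: The shadow $X$ cast by a point $U\in D$, $U\neq\mu$, with light source at $\mu\in D$ is the point where the ray starting at $\mu$ and passing through $U$ meets the unit circle $\{x^2+y^2=1\}$, i.e. the point $\mu+t(U-\mu)$ with $t>0$ lying on the unit circle (it exists and is unique for almost every $U$; the exceptional set, such as $U=\mu$, has probability zero and may be ignored). Expectations of random vectors in $\mathbb{R}^2$ are taken coordinatewise. *)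

theory Defs
  imports "HOL-Probability.Probability"
begin

definition disc :: "(real ^ 2) set" where
  "disc = {p. (p $ 1)\<^sup>2 + (p $ 2)\<^sup>2 \<le> 1}"

definition unit_circle :: "(real ^ 2) set" where
  "unit_circle = {p. (p $ 1)\<^sup>2 + (p $ 2)\<^sup>2 = 1}"

(* The condition t > 0 is strict: a light source on the circle is not its own shadow.
   For light source and u in disc with u different from the light source, the point exists and
   is unique; where it does not (in particular for u equal to the light source) the value is
   unspecified. *)
definition shadow :: "real ^ 2 \<Rightarrow> real ^ 2 \<Rightarrow> real ^ 2" where
  "shadow \<mu> u = (THE x. x \<in> unit_circle \<and> (\<exists>t>0. x = \<mu> + t *\<^sub>R (u - \<mu>)))"

definition uniform_in_disc :: "'a measure \<Rightarrow> ('a \<Rightarrow> real ^ 2) \<Rightarrow> bool" where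
  "uniform_in_disc M U \<longleftrightarrow>
     U \<in> borel_measurable M \<and> distr M lborel U = uniform_measure lborel disc"

(* The Bochner integral of a non-integrable function is 0 by convention, so integrability of the
   coordinates has to be asserted separately. *)
definition vec_integrable :: "'a measure \<Rightarrow> ('a \<Rightarrow> real ^ 2) \<Rightarrow> bool" where
  "vec_integrable M X \<longleftrightarrow> (\<forall>i. integrable M (\<lambda>\<omega>. X \<omega> $ i))"

definition vec_expectation :: "'a measure \<Rightarrow> ('a \<Rightarrow> real ^ 2) \<Rightarrow> real ^ 2" where
  "vec_expectation M X = (\<chi> i. integral\<^sup>L M (\<lambda>\<omega>. X \<omega> $ i))"

end

(* Parametrise the disc by u = mu + s (x - mu) with s in (0,1) and x = (cos theta, sin theta)
   on the circle, so that x is the shadow of u. The Jacobian is s (1 - mu . x), hence the shadow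
   has density (1 - mu . x) / (2 pi) with respect to the angle, and
   E X = (1 / 2 pi) * (integral of (1 - mu . x) x over the circle) = - mu / 2. *)
theory Submission
  imports Defs
begin

section \<open>Disc, circle and the shadow as a root of a quadratic\<close>

lemma power2_norm_real_2: "(norm (x :: real ^ 2))\<^sup>2 = (x $ 1)\<^sup>2 + (x $ 2)\<^sup>2"
  by (simp only: power2_norm_eq_inner) (simp add: inner_vec_def sum_2 power2_eq_square)

lemma disc_eq_cball: "disc = cball 0 1"
  by (auto simp: disc_def power2_norm_real_2[symmetric] abs_square_le_1)

lemma unit_circle_eq_sphere: "unit_circle = sphere 0 1"
  by (auto simp: unit_circle_def power2_norm_real_2[symmetric] power2_eq_1_iff)
     (smt (verit) norm_ge_zero)

text \<open>The larger root t of the quadratic equation |\<mu> + t (u - \<mu>)|^2 = 1; it is 0 for u = \<mu>,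
  since x / 0 = 0.\<close>
definition shadow_time :: "real ^ 2 \<Rightarrow> real ^ 2 \<Rightarrow> real" where
  "shadow_time \<mu> u = (sqrt ((\<mu> \<bullet> (u - \<mu>))\<^sup>2 + (norm (u - \<mu>))\<^sup>2 * (1 - (norm \<mu>)\<^sup>2)) - \<mu> \<bullet> (u - \<mu>))
     / (norm (u - \<mu>))\<^sup>2"

text \<open>With \<open>a\<close>, \<open>b\<close>, \<open>k\<close> as in the proof, lying on the
  circle means \<open>a * t^2 + 2 * b * t = k\<close>. Multiplying by \<open>a > 0\<close> and
  completing the square gives \<open>(a * t + b)^2 = r^2\<close> with
  \<open>r^2 = b^2 + a * k\<close>. Since \<open>k \<ge> 0\<close>, \<open>r\<close> is at least the
  absolute value of \<open>b\<close>, so the root with \<open>- r\<close> is excluded for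
  \<open>t > 0\<close>. The point \<open>u\<close> may lie outside the disc.\<close>

lemma on_circle_iff_shadow_time:
  assumes "\<mu> \<in> disc" "u \<noteq> \<mu>" "t > 0"
  shows "\<mu> + t *\<^sub>R (u - \<mu>) \<in> unit_circle \<longleftrightarrow> t = shadow_time \<mu> u"
proof -
  define a where "a = (norm (u - \<mu>))\<^sup>2"
  define b where "b = \<mu> \<bullet> (u - \<mu>)"
  define k where "k = 1 - (norm \<mu>)\<^sup>2"
  have a: "a > 0" using assms by (simp add: a_def)
  have k: "k \<ge> 0" using assms by (simp add: disc_eq_cball k_def abs_square_le_1)
  define r where "r = sqrt (b\<^sup>2 + a * k)"
  have r2: "r\<^sup>2 = b\<^sup>2 + a * k" using a k by (simp add: r_def)
  have r: "r \<ge> \<bar>b\<bar>" unfolding r_def using a k by (intro real_le_rsqrt) simp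
  have "\<mu> + t *\<^sub>R (u - \<mu>) \<in> unit_circle \<longleftrightarrow> (norm (\<mu> + t *\<^sub>R (u - \<mu>)))\<^sup>2 = 1"
    by (simp add: unit_circle_def power2_norm_real_2)
  also have "(norm (\<mu> + t *\<^sub>R (u - \<mu>)))\<^sup>2 = 1 - k + 2 * t * b + t\<^sup>2 * a"
    unfolding a_def b_def k_def power2_norm_eq_inner
    by (simp only: inner_add_left inner_add_right inner_scaleR_left inner_scaleR_right)
       (simp add: inner_commute algebra_simps power2_eq_square)
  also have "1 - k + 2 * t * b + t\<^sup>2 * a = 1 \<longleftrightarrow> a * (2 * t * b + t\<^sup>2 * a - k) = 0"
    using a by auto
  also have "a * (2 * t * b + t\<^sup>2 * a - k) = (a * t + b)\<^sup>2 - r\<^sup>2"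
    unfolding r2 by (simp add: algebra_simps power2_eq_square)
  also have "\<dots> = 0 \<longleftrightarrow> a * t + b = r \<or> a * t + b = - r"
    by (simp add: power2_eq_iff)
  also have "\<dots> \<longleftrightarrow> a * t + b = r"
    using r mult_pos_pos[OF a assms(3)] by linarith
  also have "\<dots> \<longleftrightarrow> t = (r - b) / a"
    using a by (auto simp: field_simps)
  finally show ?thesis
    by (simp add: shadow_time_def r_def a_def b_def k_def)
qed

lemma shadow_eqI:
  assumes "\<mu> \<in> disc" "u \<noteq> \<mu>" "t > 0" "\<mu> + t *\<^sub>R (u - \<mu>) \<in> unit_circle"
  shows "shadow \<mu> u = \<mu> + t *\<^sub>R (u - \<mu>)"
  unfolding shadow_def
  by (rule the_equality) (use assms on_circle_iff_shadow_time in blast)+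

text \<open>Replaces the definite description by a case distinction on an explicit function, from
  which measurability can be read off. If the root is not positive, the predicate under
  \<open>THE\<close> is identically false, so the value is a constant independent of
  \<open>u\<close>.\<close>

lemma shadow_eq_shadow_time:
  assumes "\<mu> \<in> disc" "u \<noteq> \<mu>"
  shows "shadow \<mu> u =
    (if shadow_time \<mu> u > 0 then \<mu> + shadow_time \<mu> u *\<^sub>R (u - \<mu>) else (THE x. False))"
proof (cases "shadow_time \<mu> u > 0")
  case True
  then show ?thesis
    using shadow_eqI on_circle_iff_shadow_time assms by auto
next
  case False
  have "(\<lambda>x. x \<in> unit_circle \<and> (\<exists>t>0. x = \<mu> + t *\<^sub>R (u - \<mu>))) = (\<lambda>x. False)"
    using False on_circle_iff_shadow_time[OF assms] by auto
  then have "shadow \<mu> u = (THE x. False)" unfolding shadow_def by (rule arg_cong)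
  then show ?thesis using False by simp
qed

text \<open>Only positivity of the root is at stake, that is
  \<open>b < sqrt (b\<^sup>2 + a * k)\<close>. For \<mu> inside the circle, \<open>a * k > 0\<close>
  makes this strict. For \<mu> on the circle, \<open>k = 0\<close>, and the squared norm
  \<open>1 + 2 * b + a\<close> of \<open>u\<close>, being at most 1, forces
  \<open>b < 0\<close>.\<close>

lemma shadow_in_unit_circle:
  assumes "\<mu> \<in> disc" "u \<in> disc" "u \<noteq> \<mu>"
  shows "shadow \<mu> u \<in> unit_circle" "\<exists>t>0. shadow \<mu> u = \<mu> + t *\<^sub>R (u - \<mu>)"
proof -
  define a where "a = (norm (u - \<mu>))\<^sup>2"
  define b where "b = \<mu> \<bullet> (u - \<mu>)"
  define k where "k = 1 - (norm \<mu>)\<^sup>2"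
  have a: "a > 0" using assms by (simp add: a_def)
  have k: "k \<ge> 0" using assms by (simp add: disc_eq_cball k_def abs_square_le_1)
  have u: "(norm u)\<^sup>2 \<le> 1" using assms by (simp add: disc_eq_cball abs_square_le_1)
  have "(norm u)\<^sup>2 = 1 - k + 2 * b + a"
    unfolding a_def b_def k_def power2_norm_eq_inner
    by (simp add: inner_commute algebra_simps)
  then have neg: "b < 0" if "k = 0" using u a that by linarith
  have "sqrt (b\<^sup>2 + a * k) > b"
  proof (cases "k = 0")
    case True
    then show ?thesis using neg by simp
  next
    case False
    then have "b\<^sup>2 < b\<^sup>2 + a * k" using a k by simp
    then show ?thesis by (rule real_less_rsqrt)
  qed
  then have "shadow_time \<mu> u > 0"
    using a unfolding shadow_time_def a_def b_def k_def by simp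
  then show "shadow \<mu> u \<in> unit_circle" "\<exists>t>0. shadow \<mu> u = \<mu> + t *\<^sub>R (u - \<mu>)"
    using assms shadow_eqI on_circle_iff_shadow_time by metis+
qed

text \<open>Measurability has to hold on the whole plane, including the points u outside the disc at
  which the shadow does not exist and \<^const>\<open>shadow\<close> takes the fixed junk value of
  \<^term>\<open>THE x. False\<close>.\<close>
lemma borel_measurable_shadow:
  assumes "\<mu> \<in> disc"
  shows "shadow \<mu> \<in> borel_measurable borel"
proof -
  have [measurable]: "shadow_time \<mu> \<in> borel_measurable borel"
    unfolding shadow_time_def by measurable
  have eq: "shadow \<mu> = (\<lambda>u. if u = \<mu> then shadow \<mu> \<mu> else
    if shadow_time \<mu> u > 0 then \<mu> + shadow_time \<mu> u *\<^sub>R (u - \<mu>) else (THE x. False))"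
    using shadow_eq_shadow_time[OF assms] by auto
  show ?thesis
    by (subst eq) measurable
qed

section \<open>Polar chart of the disc centred at the light source\<close>

definition circle_point :: "real \<Rightarrow> real ^ 2" where
  "circle_point \<theta> = cos \<theta> *\<^sub>R axis 1 1 + sin \<theta> *\<^sub>R axis 2 1"

lemma circle_point_nth [simp]: "circle_point \<theta> $ 1 = cos \<theta>" "circle_point \<theta> $ 2 = sin \<theta>"
  by (simp_all add: circle_point_def axis_def)

lemma norm_circle_point [simp]: "norm (circle_point \<theta>) = 1"
proof -
  have "(norm (circle_point \<theta>))\<^sup>2 = 1" by (simp add: power2_norm_real_2)
  then show ?thesis by (simp add: power2_eq_1_iff) (smt (verit) norm_ge_zero)
qed

lemma circle_point_eqD:
  assumes "circle_point x = circle_point y" "0 \<le> x" "x < 2 * pi" "0 \<le> y" "y < 2 * pi"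
  shows "x = y"
proof -
  have "sin x = sin y" "cos x = cos y" using assms(1) by (metis circle_point_nth)+
  then obtain n :: int where n: "x = y + 2 * pi * n" using sin_cos_eq_iff by metis
  have "\<bar>2 * pi * n\<bar> < 2 * pi" using assms n by linarith
  then have "\<bar>real_of_int n\<bar> < 1" by (simp add: abs_mult)
  then show ?thesis using n by simp
qed

text \<open>Polar coordinates with pole \<mu>, the radius rescaled on each ray so that the circle
  sits at \<open>p $ 1 = 1\<close>. Both coordinates are packed into a vector of
  \<open>real ^ 2\<close> because the Jacobian determinant and the change of variables formula are
  stated for such vectors.\<close>

definition chart :: "real ^ 2 \<Rightarrow> real ^ 2 \<Rightarrow> real ^ 2" where
  "chart \<mu> p = \<mu> + (p $ 1) *\<^sub>R (circle_point (p $ 2) - \<mu>)"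

definition chart_deriv :: "real ^ 2 \<Rightarrow> real ^ 2 \<Rightarrow> real ^ 2 \<Rightarrow> real ^ 2" where
  "chart_deriv \<mu> p h = (h $ 1) *\<^sub>R (circle_point (p $ 2) - \<mu>)
     + (p $ 1 * h $ 2) *\<^sub>R (cos (p $ 2) *\<^sub>R axis 2 1 - sin (p $ 2) *\<^sub>R axis 1 1)"

text \<open>For \<mu> on the circle the whole segment over the angle of \<mu> is mapped to \<mu>, so that
  angle is removed to keep the chart injective.\<close>
definition chart_dom :: "real ^ 2 \<Rightarrow> (real ^ 2) set" where
  "chart_dom \<mu> = {p. 0 < p $ 1 \<and> p $ 1 < 1 \<and> 0 \<le> p $ 2 \<and> p $ 2 < 2 * pi \<and> circle_point (p $ 2) \<noteq> \<mu>}"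

lemma has_derivative_nth [derivative_intros]:
  "((\<lambda>x :: real ^ 'n. x $ i) has_derivative (\<lambda>h. h $ i)) F"
  by (rule bounded_linear_imp_has_derivative) (rule bounded_linear_vec_nth)

lemma has_derivative_chart:
  "(chart \<mu> has_derivative chart_deriv \<mu> p) (at p within S)"
  unfolding chart_def chart_deriv_def circle_point_def
  by (rule derivative_eq_intros refl ext)+ (simp add: algebra_simps)

text \<open>Write x for the circle point, s for \<open>p $ 1\<close>, and x' for x turned by a right
  angle. The columns are x - \<mu> and s x', and the determinant of (v, x') is the inner product of
  v with x. Hence the value is s times the inner product of x - \<mu> with x, where x has norm
  1.\<close>

lemma det_chart_deriv:
  "det (matrix (chart_deriv \<mu> p)) = p $ 1 * (1 - \<mu> \<bullet> circle_point (p $ 2))"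
proof -
  have "det (matrix (chart_deriv \<mu> p)) =
    p $ 1 * ((cos (p $ 2))\<^sup>2 + (sin (p $ 2))\<^sup>2 - \<mu> $ 1 * cos (p $ 2) - \<mu> $ 2 * sin (p $ 2))"
    unfolding det_2 matrix_def chart_deriv_def
    by (simp add: axis_def del: sin_cos_squared_add2) (simp only: algebra_simps power2_eq_square)
  then show ?thesis by (simp add: inner_vec_def sum_2)
qed

text \<open>The image lies strictly between two points of the closed ball, so strict convexity puts
  it in the open ball. Undoing the scaling with \<open>t = 1 / p $ 1\<close> leads back to the
  circle point, which is therefore the shadow.\<close>

lemma shadow_chart:
  assumes "\<mu> \<in> disc" "p \<in> chart_dom \<mu>"
  shows "chart \<mu> p \<in> ball 0 1" "chart \<mu> p \<noteq> \<mu>"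
    and "shadow \<mu> (chart \<mu> p) = circle_point (p $ 2)"
proof -
  let ?c = "circle_point (p $ 2)"
  have p: "0 < p $ 1" "p $ 1 < 1" "?c \<noteq> \<mu>" using assms by (auto simp: chart_dom_def)
  have "chart \<mu> p \<in> open_segment \<mu> ?c"
    using p by (auto simp: in_segment chart_def algebra_simps intro!: exI[of _ "p $ 1"])
  from dist_decreases_open_segment[OF this, of 0] show "chart \<mu> p \<in> ball 0 1"
    using assms(1) by (auto simp: disc_eq_cball)
  show ne: "chart \<mu> p \<noteq> \<mu>" using p by (simp add: chart_def)
  have eq: "\<mu> + (1 / p $ 1) *\<^sub>R (chart \<mu> p - \<mu>) = ?c" using p by (simp add: chart_def)
  show "shadow \<mu> (chart \<mu> p) = ?c"
    using shadow_eqI[OF assms(1) ne, of "1 / p $ 1"] p unfolding eq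
    by (simp add: unit_circle_eq_sphere)
qed

text \<open>The shadow of the image recovers the angle; the radial coordinate is then the
  coefficient of a nonzero vector.\<close>

lemma inj_on_chart:
  assumes "\<mu> \<in> disc"
  shows "inj_on (chart \<mu>) (chart_dom \<mu>)"
proof (rule inj_onI)
  fix p q assume pq: "p \<in> chart_dom \<mu>" "q \<in> chart_dom \<mu>" and eq: "chart \<mu> p = chart \<mu> q"
  have c: "circle_point (p $ 2) = circle_point (q $ 2)"
    using shadow_chart(3)[OF assms] pq eq by metis
  then have 2: "p $ 2 = q $ 2"
    using pq by (intro circle_point_eqD) (auto simp: chart_dom_def)
  have "circle_point (q $ 2) \<noteq> \<mu>" using pq by (simp add: chart_dom_def)
  then have "p $ 1 = q $ 1" using eq by (simp add: chart_def c)
  then show "p = q" using 2 by (simp add: vec_eq_iff forall_2)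
qed

text \<open>For surjectivity, the angle of a preimage is that of the shadow of \<open>u\<close>, and
  its radial coordinate is the reciprocal of the shadow parameter \<open>t\<close>.\<close>

lemma chart_image:
  assumes "\<mu> \<in> disc"
  shows "chart \<mu> ` chart_dom \<mu> = ball 0 1 - {\<mu>}"
proof (intro equalityI subsetI)
  fix u assume u: "u \<in> ball 0 1 - {\<mu>}"
  have "shadow \<mu> u \<in> unit_circle"
    using u assms by (intro shadow_in_unit_circle) (auto simp: disc_eq_cball)
  then have s: "(shadow \<mu> u $ 1)\<^sup>2 + (shadow \<mu> u $ 2)\<^sup>2 = 1" by (simp add: unit_circle_def)
  obtain \<theta> where \<theta>: "0 \<le> \<theta>" "\<theta> < 2 * pi" "shadow \<mu> u $ 1 = cos \<theta>" "shadow \<mu> u $ 2 = sin \<theta>"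
    using sincos_total_2pi[OF s] .
  have c: "circle_point \<theta> = shadow \<mu> u" using \<theta> by (simp add: vec_eq_iff forall_2)
  obtain t where t: "t > 0" "circle_point \<theta> = \<mu> + t *\<^sub>R (u - \<mu>)"
    using shadow_in_unit_circle(2)[OF assms, of u] u unfolding c by (auto simp: disc_eq_cball)
  \<comment> \<open>For \<open>t < 1\<close> the circle point would lie strictly between \<mu> and
    \<open>u\<close>, hence in the open ball; for \<open>t = 1\<close> it would equal
    \<open>u\<close>, which has norm below 1.\<close>
  have "t > 1"
  proof (rule ccontr)
    assume "\<not> t > 1"
    moreover have "t \<noteq> 1"
    proof
      assume "t = 1"
      then have "norm u = 1" using t by (metis add_diff_cancel_left' diff_add_cancel add.commute norm_circle_point scaleR_one)
      then show False using u by simp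
    qed
    ultimately have "circle_point \<theta> \<in> open_segment \<mu> u"
      using u t by (auto simp: in_segment algebra_simps intro!: exI[of _ t])
    from dist_decreases_open_segment[OF this, of 0] have False
      using assms u by (auto simp: disc_eq_cball)
    then show False .
  qed
  let ?p = "(1 / t) *\<^sub>R axis 1 1 + \<theta> *\<^sub>R axis 2 1 :: real ^ 2"
  have p: "?p $ 1 = 1 / t" "?p $ 2 = \<theta>" by (simp_all add: axis_def)
  have "?p \<in> chart_dom \<mu>" unfolding chart_dom_def mem_Collect_eq p
    using \<theta> t \<open>t > 1\<close> u by simp
  moreover have "chart \<mu> ?p = u" unfolding chart_def p using t by simp
  ultimately show "u \<in> chart \<mu> ` chart_dom \<mu>" by (metis imageI)
qed (use shadow_chart[OF assms] in auto)

section \<open>Integrals over rectangles and around the circle\<close>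

text \<open>Fubini for vectors, transferred from \<open>real \<times> real\<close> along the
  coordinate isomorphism \<open>g\<close> with inverse \<open>h\<close>.\<close>

lemma integral_cbox_cart_2:
  fixes f :: "real ^ 2 \<Rightarrow> 'b :: euclidean_space"
  assumes "continuous_on (cbox a b) f"
  shows "integral (cbox a b) f = integral {a $ 1..b $ 1} (\<lambda>x. integral {a $ 2..b $ 2}
    (\<lambda>y. f (x *\<^sub>R axis 1 1 + y *\<^sub>R axis 2 1)))"
proof -
  define h where "h = (\<lambda>q. fst q *\<^sub>R axis 1 1 + snd q *\<^sub>R axis 2 1 :: real ^ 2)"
  define g where "g = (\<lambda>p :: real ^ 2. (p $ 1, p $ 2))"
  have gh: "g (h q) = q" for q by (simp add: g_def h_def axis_def)
  have hg: "h (g p) = p" for p by (simp add: g_def h_def vec_eq_iff forall_2 axis_def)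
  have mem: "p \<in> cbox u v \<longleftrightarrow> g p \<in> cbox (g u) (g v)" for p u v
    by (auto simp: g_def mem_box_cart forall_2)
  have g_cbox: "g ` cbox u v = cbox (g u) (g v)" for u v
  proof (intro equalityI subsetI)
    fix q assume "q \<in> cbox (g u) (g v)"
    then have "h q \<in> cbox u v" by (simp add: mem gh)
    then show "q \<in> g ` cbox u v" by (metis gh imageI)
  qed (auto simp: mem[symmetric])
  have h_cbox: "h ` cbox w z = cbox (h w) (h z)" for w z
    using arg_cong[OF g_cbox[of "h w" "h z"], of "image h"] by (simp add: image_image gh hg)
  have c: "continuous_on (cbox (g a) (g b)) (\<lambda>q. f (h q))"
  proof (rule continuous_on_compose2[OF assms])
    show "continuous_on (cbox (g a) (g b)) h"
      unfolding h_def by (intro continuous_intros)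
    show "h ` cbox (g a) (g b) \<subseteq> cbox a b" by (simp add: h_cbox hg)
  qed
  \<comment> \<open>The isomorphism preserves the area of boxes, so the substitution rule applies
    with scaling factor 1.\<close>
  have "measure lborel (g ` cbox u v) = 1 * measure lborel (cbox u v)" for u v
  proof (cases "cbox u v = {}")
    case False
    then have "u $ 1 \<le> v $ 1" "u $ 2 \<le> v $ 2" by (auto simp: interval_ne_empty_cart forall_2)
    then show ?thesis using False
      unfolding g_cbox by (simp add: g_def content_Pair content_cbox_cart UNIV_2)
  qed simp
  then have "((\<lambda>p. f (h (g p))) has_integral (1 / 1) *\<^sub>R integral (cbox (g a) (g b)) (\<lambda>q. f (h q)))
      (h ` cbox (g a) (g b))"
    by (intro has_integral_twiddle)
       (use hg gh g_cbox h_cbox integrable_integral[OF integrable_continuous[OF c]] in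
         \<open>auto simp: g_def intro!: continuous_intros\<close>)
  then have "integral (cbox a b) f = integral (cbox (g a) (g b)) (\<lambda>q. f (h q))"
    unfolding hg h_cbox by (simp add: integral_unique)
  also have "\<dots> = integral {a $ 1..b $ 1} (\<lambda>x. integral {a $ 2..b $ 2} (\<lambda>y. f (h (x, y))))"
    using integral_prod_continuous[OF c[unfolded g_def]] by (simp add: g_def)
  finally show ?thesis by (simp add: h_def)
qed

text \<open>Over a full turn the linear terms and the mixed product of sine and cosine integrate to
  0, while each squared coordinate integrates to \<open>pi\<close>.\<close>

lemma has_integral_circle_density:
  "((\<lambda>\<theta>. (1 - \<mu> \<bullet> circle_point \<theta>) *\<^sub>R circle_point \<theta>) has_integral - (pi *\<^sub>R \<mu>)) {0..2 * pi}"
proof -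
  \<comment> \<open>A coordinatewise antiderivative. Between 0 and \<open>2 * pi\<close> only the
    terms \<open>\<mu> $ 1 * \<theta> / 2\<close> and \<open>\<mu> $ 2 * \<theta> / 2\<close>
    change; everything else is periodic.\<close>
  let ?F = "\<lambda>\<theta>. (sin \<theta> - \<mu> $ 1 * (\<theta> + sin \<theta> * cos \<theta>) / 2 - \<mu> $ 2 * (sin \<theta>)\<^sup>2 / 2) *\<^sub>R axis 1 1
    + (- cos \<theta> - \<mu> $ 1 * (sin \<theta>)\<^sup>2 / 2 - \<mu> $ 2 * (\<theta> - sin \<theta> * cos \<theta>) / 2) *\<^sub>R (axis 2 1 :: real ^ 2)"
  have "((\<lambda>\<theta>. (1 - \<mu> \<bullet> circle_point \<theta>) *\<^sub>R circle_point \<theta>) has_integral ?F (2 * pi) - ?F 0) {0..2 * pi}"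
  proof (rule fundamental_theorem_of_calculus)
    fix \<theta> :: real
    \<comment> \<open>The left sides are the derivatives of
      \<open>\<theta> + sin \<theta> * cos \<theta>\<close> and
      \<open>\<theta> - sin \<theta> * cos \<theta>\<close>.\<close>
    have 1: "1 + ((cos \<theta>)\<^sup>2 - (sin \<theta>)\<^sup>2) = 2 * (cos \<theta>)\<^sup>2" "1 - ((cos \<theta>)\<^sup>2 - (sin \<theta>)\<^sup>2) = 2 * (sin \<theta>)\<^sup>2"
      using sin_cos_squared_add[of \<theta>] by linarith+
    have 2: "cos \<theta> * (cos \<theta> * z) + sin \<theta> * (sin \<theta> * z) = z" for z :: real
      using arg_cong[OF sin_cos_squared_add3[of \<theta>], of "\<lambda>a. a * z"]
      by (simp only: distrib_right mult.assoc mult_1_left)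
    show "(?F has_vector_derivative (1 - \<mu> \<bullet> circle_point \<theta>) *\<^sub>R circle_point \<theta>) (at \<theta> within {0..2 * pi})"
    proof (rule has_vector_derivative_eq_rhs)
      show "(?F has_vector_derivative
          (cos \<theta> - \<mu> $ 1 * (1 + ((cos \<theta>)\<^sup>2 - (sin \<theta>)\<^sup>2)) / 2 - \<mu> $ 2 * (2 * sin \<theta> * cos \<theta>) / 2) *\<^sub>R axis 1 1
        + (sin \<theta> - \<mu> $ 1 * (2 * sin \<theta> * cos \<theta>) / 2 - \<mu> $ 2 * (1 - ((cos \<theta>)\<^sup>2 - (sin \<theta>)\<^sup>2)) / 2) *\<^sub>R axis 2 1)
        (at \<theta> within {0..2 * pi})"
        by (auto intro!: derivative_eq_intros simp: has_real_derivative_iff_has_vector_derivative[symmetric] power2_eq_square mult_ac)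
    qed (simp add: 1 2 vec_eq_iff forall_2 axis_def inner_vec_def sum_2 algebra_simps power2_eq_square)
  qed simp
  moreover have "?F (2 * pi) - ?F 0 = - (pi *\<^sub>R \<mu>)"
    by (simp add: vec_eq_iff forall_2 axis_def)
  ultimately show ?thesis by simp
qed

section \<open>Change of variables from the rectangle to the disc\<close>

lemma chart_dom_almost_box:
  "chart_dom \<mu> \<in> sets lebesgue"
  "chart_dom \<mu> \<subseteq> cbox 0 (axis 1 1 + (2 * pi) *\<^sub>R axis 2 1)" (is "_ \<subseteq> ?B")
  "negligible (cbox 0 (axis 1 1 + (2 * pi) *\<^sub>R axis 2 1) - chart_dom \<mu>)"
proof -
  have "continuous_on UNIV circle_point"
    unfolding circle_point_def by (intro continuous_intros)
  then have [measurable]: "circle_point \<in> borel_measurable borel"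
    by (rule borel_measurable_continuous_onI)
  have "chart_dom \<mu> \<in> sets borel"
    unfolding chart_dom_def by measurable
  then show "chart_dom \<mu> \<in> sets lebesgue" by simp
  show "chart_dom \<mu> \<subseteq> ?B"
    by (auto simp: chart_dom_def mem_box_cart forall_2 axis_def)
  \<comment> \<open>The angle of \<mu> if \<mu> lies on the circle. Otherwise the choice is
    arbitrary, and one further line in the null set does no harm.\<close>
  define \<theta> where "\<theta> = (SOME \<theta>. 0 \<le> \<theta> \<and> \<theta> < 2 * pi \<and> circle_point \<theta> = \<mu>)"
  have \<theta>: "t = \<theta>" if "0 \<le> t" "t < 2 * pi" "circle_point t = \<mu>" for t
    using someI[of "\<lambda>\<theta>. 0 \<le> \<theta> \<and> \<theta> < 2 * pi \<and> circle_point \<theta> = \<mu>" t] that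
      circle_point_eqD[of t \<theta>] unfolding \<theta>_def by auto
  show "negligible (?B - chart_dom \<mu>)"
  proof (rule negligible_subset)
    have "negligible {p :: real ^ 2. p $ i = c}" for i c
      using negligible_standard_hyperplane[of "axis i 1 :: real ^ 2" c] by (simp add: inner_axis axis_in_Basis_iff)
    then show "negligible ({p :: real ^ 2. p $ 1 = 0} \<union> {p. p $ 1 = 1} \<union> {p. p $ 2 = 2 * pi} \<union> {p. p $ 2 = \<theta>})"
      by (simp only: negligible_Un_eq simp_thms)
    show "?B - chart_dom \<mu> \<subseteq> {p. p $ 1 = 0} \<union> {p. p $ 1 = 1} \<union> {p. p $ 2 = 2 * pi} \<union> {p. p $ 2 = \<theta>}"
      using \<theta> by (fastforce simp: chart_dom_def mem_box_cart forall_2 axis_def)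
  qed
qed

text \<open>The pulled-back integrand \<open>F\<close> is continuous on a compact box, hence
  absolutely integrable, and the change of variables carries both integrability and value over to
  the disc. The inner angular integral is \<open>s *\<^sub>R - (pi *\<^sub>R \<mu>)\<close>, and
  integrating \<open>s\<close> over the unit interval gives the factor 1/2.\<close>

lemma integral_shadow:
  assumes "\<mu> \<in> disc"
  shows "integral disc (shadow \<mu>) = - ((pi / 2) *\<^sub>R \<mu>)"
proof -
  let ?B = "cbox 0 (axis 1 1 + (2 * pi) *\<^sub>R axis 2 1) :: (real ^ 2) set"
  define F where "F p = (p $ 1 * (1 - \<mu> \<bullet> circle_point (p $ 2))) *\<^sub>R circle_point (p $ 2)" for p :: "real ^ 2"
  have c: "continuous_on ?B F"
    unfolding F_def circle_point_def by (intro continuous_intros)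
  have "integral ?B F = integral {0..1} (\<lambda>s. integral {0..2 * pi}
      (\<lambda>\<theta>. s *\<^sub>R ((1 - \<mu> \<bullet> circle_point \<theta>) *\<^sub>R circle_point \<theta>)))"
    unfolding integral_cbox_cart_2[OF c] by (simp add: F_def axis_def)
  also have "\<dots> = integral {0..1} (\<lambda>s. s *\<^sub>R - (pi *\<^sub>R \<mu>))"
    by (simp only: integral_cmul integral_unique[OF has_integral_circle_density])
  also have "\<dots> = - ((pi / 2) *\<^sub>R \<mu>)"
    using has_integral_scaleR_left[OF ident_has_integral[of 0 "1 :: real"], of "- (pi *\<^sub>R \<mu>)"]
    by (intro integral_unique) simp
  finally have iF: "integral ?B F = - ((pi / 2) *\<^sub>R \<mu>)" .
  have aB: "F absolutely_integrable_on ?B"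
    using c by (rule absolutely_integrable_continuous)
  have a: "F absolutely_integrable_on chart_dom \<mu>"
    using aB chart_dom_almost_box(1,2) by (rule set_integrable_subset)
  have i: "integral (chart_dom \<mu>) F = integral ?B F"
    by (rule integral_subset_negligible[OF chart_dom_almost_box(2,3)])
  have F: "\<bar>det (matrix (chart_deriv \<mu> p))\<bar> *\<^sub>R shadow \<mu> (chart \<mu> p) = F p" if "p \<in> chart_dom \<mu>" for p
  proof -
    have "\<mu> \<bullet> circle_point (p $ 2) \<le> norm \<mu> * norm (circle_point (p $ 2))"
      by (rule norm_cauchy_schwarz)
    also have "\<dots> \<le> 1" using assms by (simp add: disc_eq_cball)
    finally show ?thesis
      using that unfolding det_chart_deriv shadow_chart(3)[OF assms that] F_def
      by (simp add: chart_dom_def)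
  qed
  have "(\<lambda>p. \<bar>det (matrix (chart_deriv \<mu> p))\<bar> *\<^sub>R shadow \<mu> (chart \<mu> p)) absolutely_integrable_on chart_dom \<mu>
    \<and> integral (chart_dom \<mu>) (\<lambda>p. \<bar>det (matrix (chart_deriv \<mu> p))\<bar> *\<^sub>R shadow \<mu> (chart \<mu> p)) = - ((pi / 2) *\<^sub>R \<mu>)"
    using a i iF F by (simp cong: set_integrable_cong Henstock_Kurzweil_Integration.integral_cong)
  then have "integral (ball 0 1 - {\<mu>}) (shadow \<mu>) = - ((pi / 2) *\<^sub>R \<mu>)"
    using has_absolute_integral_change_of_variables[OF chart_dom_almost_box(1) has_derivative_chart inj_on_chart[OF assms]]
    unfolding chart_image[OF assms] by blast
  moreover have "integral (ball 0 1 - {\<mu>}) (shadow \<mu>) = integral disc (shadow \<mu>)"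
    unfolding disc_eq_cball
  proof (rule integral_subset_negligible)
    show "negligible (cball 0 1 - (ball 0 1 - {\<mu>}))"
      by (rule negligible_subset[of "sphere 0 1 \<union> {\<mu>}"]) (auto simp: negligible_sphere intro!: negligible_Un)
  qed auto
  ultimately show ?thesis by simp
qed

section \<open>Uniform law on the disc and the expectation of the shadow\<close>

lemma emeasure_disc: "emeasure lborel disc = ennreal pi"
  by (simp add: disc_eq_cball emeasure_cball unit_ball_vol_2)

text \<open>Moves the quotient from extended nonnegative reals to the reals, the form in which
  Bochner integrals against a density are evaluated.\<close>

lemma uniform_measure_disc:
  "uniform_measure lborel disc = density lborel (\<lambda>u. ennreal (indicator disc u / pi))"
  unfolding uniform_measure_def emeasure_disc
  by (intro density_cong) (auto simp: disc_eq_cball divide_ennreal simp flip: ennreal_indicator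
      intro!: borel_measurable_divide borel_measurable_indicator)

lemma AE_uniform_in_disc_neq:
  assumes "uniform_in_disc M U"
  shows "AE \<omega> in M. U \<omega> \<in> disc \<and> U \<omega> \<noteq> \<mu>"
proof -
  have m: "U \<in> measurable M lborel" and d: "distr M lborel U = uniform_measure lborel disc"
    using assms by (auto simp: uniform_in_disc_def)
  have "AE u in uniform_measure lborel disc. u \<in> disc \<and> u \<noteq> \<mu>"
    by (rule AE_uniform_measureI) (use AE_lborel_singleton[of \<mu>] in \<open>auto simp: disc_eq_cball elim: eventually_mono\<close>)
  then show ?thesis unfolding d[symmetric]
    using m by (subst (asm) AE_distr_iff) (auto simp: disc_eq_cball)
qed

text \<open>Almost surely the shadow exists and its coordinates are bounded by 1, which gives
  integrability. Pushing the integral forward along \<open>U\<close> leaves \<open>1 / pi\<close>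
  times the integral over the disc.\<close>

lemma expectation_shadow:
  assumes "uniform_in_disc M U" "prob_space M" "\<mu> \<in> disc"
  shows "vec_integrable M (\<lambda>\<omega>. shadow \<mu> (U \<omega>))"
    and "vec_expectation M (\<lambda>\<omega>. shadow \<mu> (U \<omega>)) = - (1 / 2) *\<^sub>R \<mu>"
proof -
  interpret prob_space M by fact
  have m: "U \<in> measurable M lborel" and d: "distr M lborel U = uniform_measure lborel disc"
    using assms by (auto simp: uniform_in_disc_def)
  have mb: "U \<in> borel_measurable M" using assms(1) by (simp add: uniform_in_disc_def)
  have sm: "(\<lambda>u. shadow \<mu> u $ i) \<in> borel_measurable borel" for i
    by (rule measurable_compose[OF borel_measurable_shadow[OF assms(3)]]) measurable
  have bound: "\<bar>shadow \<mu> u $ i\<bar> \<le> 1" if "u \<in> disc" "u \<noteq> \<mu>" for u i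
    using shadow_in_unit_circle(1)[OF assms(3) that] component_le_norm_cart[of "shadow \<mu> u" i]
    by (simp add: unit_circle_eq_sphere)
  have int: "integrable M (\<lambda>\<omega>. shadow \<mu> (U \<omega>) $ i)" for i
  proof (rule integrable_const_bound[of _ 1])
    show "AE \<omega> in M. norm (shadow \<mu> (U \<omega>) $ i) \<le> 1"
      using AE_uniform_in_disc_neq[OF assms(1), of \<mu>] by eventually_elim (simp add: bound)
  qed (rule measurable_compose[OF mb sm])
  then show "vec_integrable M (\<lambda>\<omega>. shadow \<mu> (U \<omega>))" by (simp add: vec_integrable_def)
  \<comment> \<open>Lebesgue integrability on the disc identifies the Lebesgue integral with the
    gauge integral computed in \<open>integral_shadow\<close>.\<close>
  have si: "set_integrable lborel disc (\<lambda>u. shadow \<mu> u)"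
    unfolding set_integrable_def
  proof (rule integrableI_bounded_set[of disc _ _ 1])
    show "AE u in lborel. u \<in> disc \<longrightarrow> norm (indicator disc u *\<^sub>R shadow \<mu> u) \<le> 1"
      using AE_lborel_singleton[of \<mu>]
      by eventually_elim (use shadow_in_unit_circle(1)[OF assms(3)] in \<open>auto simp: unit_circle_eq_sphere\<close>)
  qed (auto simp: emeasure_disc, auto simp: disc_eq_cball 
      intro!: borel_measurable_scaleR borel_measurable_indicator borel_measurable_shadow[OF assms(3)])
  have "(\<integral>\<omega>. shadow \<mu> (U \<omega>) $ i \<partial>M) = - (1 / 2) * \<mu> $ i" for i
  proof -
    have "(\<integral>\<omega>. shadow \<mu> (U \<omega>) $ i \<partial>M) = (\<integral>u. shadow \<mu> u $ i \<partial>uniform_measure lborel disc)"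
      unfolding d[symmetric] using m sm by (subst integral_distr) auto
    also have "\<dots> = (\<integral>u. (indicator disc u / pi) *\<^sub>R shadow \<mu> u $ i \<partial>lborel)"
      unfolding uniform_measure_disc using sm by (subst integral_density) (auto simp: disc_eq_cball intro!: borel_measurable_divide borel_measurable_indicator)
    also have "\<dots> = (\<integral>u. (1 / pi) * ((indicator disc u *\<^sub>R shadow \<mu> u) $ i) \<partial>lborel)"
      by (intro Bochner_Integration.integral_cong) auto
    also have "\<dots> = (1 / pi) * (LINT u : disc | lborel. shadow \<mu> u) $ i"
      using integral_bounded_linear[OF bounded_linear_vec_nth si[unfolded set_integrable_def]]
      by (simp add: set_lebesgue_integral_def)
    also have "(LINT u : disc | lborel. shadow \<mu> u) = - ((pi / 2) *\<^sub>R \<mu>)"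
      using set_borel_integral_eq_integral(2)[OF si] integral_shadow[OF assms(3)] by simp
    finally show ?thesis by simp
  qed
  then show "vec_expectation M (\<lambda>\<omega>. shadow \<mu> (U \<omega>)) = - (1 / 2) *\<^sub>R \<mu>"
    by (simp add: vec_expectation_def vec_eq_iff)
qed

section \<open>Distance from the disc and unbiasedness\<close>

text \<open>The radial projection \<open>(r / norm x) *\<^sub>R x\<close> attains the distance; the
  reverse triangle inequality gives the lower bound.\<close>

lemma infdist_cball_outside:
  assumes "r \<le> norm x" "0 \<le> r" "x \<noteq> (0 :: 'a :: euclidean_space)"
  shows "infdist x (cball 0 r) = norm x - r"
proof -
  have "x - (r / norm x) *\<^sub>R x = (1 - r / norm x) *\<^sub>R x" by (simp add: algebra_simps)
  then have "dist x ((r / norm x) *\<^sub>R x) = \<bar>(1 - r / norm x) * norm x\<bar>"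
    by (simp add: dist_norm abs_mult)
  also have "\<dots> = norm x - r" using assms by (simp add: left_diff_distrib)
  finally have "dist x ((r / norm x) *\<^sub>R x) = norm x - r" .
  moreover have "infdist x (cball 0 r) \<le> dist x ((r / norm x) *\<^sub>R x)"
    by (rule infdist_le) (use assms in auto)
  ultimately have "infdist x (cball 0 r) \<le> norm x - r" by simp
  moreover have "norm x - r \<le> infdist x (cball 0 r)"
    unfolding infdist_def using assms(2)
    by (auto intro!: cINF_greatest) (smt (verit) dist_norm norm_triangle_ineq2)
  ultimately show ?thesis by simp
qed

lemma neg_double_circle_point_outside_disc:
  assumes "x \<in> unit_circle"
  shows "(- 2) *\<^sub>R x \<notin> disc \<and> infdist ((- 2) *\<^sub>R x) disc = 1"
  using assms infdist_cball_outside[of 1 "(- 2) *\<^sub>R x"]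
  by (cases "x = 0") (auto simp: disc_eq_cball unit_circle_eq_sphere)

theorem mainTheorem2:
  fixes M :: "real ^ 2 \<Rightarrow> 'a measure"
    and U X :: "real ^ 2 \<Rightarrow> 'a \<Rightarrow> real ^ 2"
  assumes prob: "\<And>\<mu>. \<mu> \<in> disc \<Longrightarrow> prob_space (M \<mu>)"
    and unif: "\<And>\<mu>. \<mu> \<in> disc \<Longrightarrow> uniform_in_disc (M \<mu>) (U \<mu>)"
    and X_def: "\<And>\<mu> \<omega>. X \<mu> \<omega> = shadow \<mu> (U \<mu> \<omega>)"
  shows "(\<forall>\<mu>\<in>disc. vec_integrable (M \<mu>) (X \<mu>)
                  \<and> vec_expectation (M \<mu>) (X \<mu>) = - (1 / 2) *\<^sub>R \<mu>)
    \<and> (\<forall>c::real. (\<forall>\<mu>\<in>disc. vec_integrable (M \<mu>) (\<lambda>\<omega>. c *\<^sub>R X \<mu> \<omega>)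
                          \<and> vec_expectation (M \<mu>) (\<lambda>\<omega>. c *\<^sub>R X \<mu> \<omega>) = \<mu>) \<longleftrightarrow> c = - 2)
    \<and> (\<forall>\<mu>\<in>disc. \<forall>\<omega>\<in>space (M \<mu>). U \<mu> \<omega> \<in> disc \<and> U \<mu> \<omega> \<noteq> \<mu> \<longrightarrow>
          (- 2) *\<^sub>R X \<mu> \<omega> \<notin> disc \<and> infdist ((- 2) *\<^sub>R X \<mu> \<omega>) disc = 1)
    \<and> (\<forall>\<mu>\<in>disc. AE \<omega> in M \<mu>.
          (- 2) *\<^sub>R X \<mu> \<omega> \<notin> disc \<and> infdist ((- 2) *\<^sub>R X \<mu> \<omega>) disc = 1)"
proof (intro conjI ballI allI impI)
  fix \<mu> :: "real ^ 2" assume \<mu>: "\<mu> \<in> disc"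
  note ex = expectation_shadow[OF unif[OF \<mu>] prob[OF \<mu>] \<mu>, folded X_def]
  show "vec_integrable (M \<mu>) (X \<mu>)" "vec_expectation (M \<mu>) (X \<mu>) = - (1 / 2) *\<^sub>R \<mu>"
    using ex by simp_all
  \<comment> \<open>Holds pointwise wherever the shadow exists; the almost sure version follows
    because \<open>U \<mu>\<close> almost surely lands in the disc and misses \<mu>.\<close>
  have *: "(- 2) *\<^sub>R X \<mu> \<omega> \<notin> disc \<and> infdist ((- 2) *\<^sub>R X \<mu> \<omega>) disc = 1"
    if "U \<mu> \<omega> \<in> disc \<and> U \<mu> \<omega> \<noteq> \<mu>" for \<omega>
    using neg_double_circle_point_outside_disc shadow_in_unit_circle(1)[OF \<mu>] that by (simp add: X_def)
  show "(- 2) *\<^sub>R X \<mu> \<omega> \<notin> disc" "infdist ((- 2) *\<^sub>R X \<mu> \<omega>) disc = 1"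
    if "U \<mu> \<omega> \<in> disc \<and> U \<mu> \<omega> \<noteq> \<mu>" for \<omega>
    using *[OF that] by blast+
  show "AE \<omega> in M \<mu>. (- 2) *\<^sub>R X \<mu> \<omega> \<notin> disc \<and> infdist ((- 2) *\<^sub>R X \<mu> \<omega>) disc = 1"
    using AE_uniform_in_disc_neq[OF unif[OF \<mu>], of \<mu>] by eventually_elim (rule *)
next
  fix c :: real
  have scale: "vec_integrable (M \<mu>) (\<lambda>\<omega>. c *\<^sub>R X \<mu> \<omega>)"
      "vec_expectation (M \<mu>) (\<lambda>\<omega>. c *\<^sub>R X \<mu> \<omega>) = (- c / 2) *\<^sub>R \<mu>" if \<mu>: "\<mu> \<in> disc" for \<mu>
  proof -
    note ex = expectation_shadow[OF unif[OF \<mu>] prob[OF \<mu>] \<mu>, folded X_def]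
    show "vec_integrable (M \<mu>) (\<lambda>\<omega>. c *\<^sub>R X \<mu> \<omega>)"
      using ex(1) by (simp add: vec_integrable_def)
    show "vec_expectation (M \<mu>) (\<lambda>\<omega>. c *\<^sub>R X \<mu> \<omega>) = (- c / 2) *\<^sub>R \<mu>"
      using ex(2) by (simp add: vec_expectation_def vec_eq_iff)
  qed
  show "(\<forall>\<mu>\<in>disc. vec_integrable (M \<mu>) (\<lambda>\<omega>. c *\<^sub>R X \<mu> \<omega>)
      \<and> vec_expectation (M \<mu>) (\<lambda>\<omega>. c *\<^sub>R X \<mu> \<omega>) = \<mu>) \<longleftrightarrow> c = - 2"
  proof
    assume "\<forall>\<mu>\<in>disc. vec_integrable (M \<mu>) (\<lambda>\<omega>. c *\<^sub>R X \<mu> \<omega>)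
      \<and> vec_expectation (M \<mu>) (\<lambda>\<omega>. c *\<^sub>R X \<mu> \<omega>) = \<mu>"
    \<comment> \<open>A single nonzero light source determines \<open>c\<close>; the point (1, 0) is
      chosen, and its first coordinate yields \<open>- c / 2 = 1\<close>.\<close>
    moreover have e: "circle_point 0 \<in> disc" by (simp add: disc_eq_cball)
    ultimately have "(- c / 2) *\<^sub>R circle_point 0 = circle_point 0" using scale(2) by metis
    then have "(- c / 2) * circle_point 0 $ 1 = circle_point 0 $ 1" by (metis vector_scaleR_component real_scaleR_def)
    then show "c = - 2" by simp
  next
    assume "c = - 2"
    then show "\<forall>\<mu>\<in>disc. vec_integrable (M \<mu>) (\<lambda>\<omega>. c *\<^sub>R X \<mu> \<omega>)
      \<and> vec_expectation (M \<mu>) (\<lambda>\<omega>. c *\<^sub>R X \<mu> \<omega>) = \<mu>" using scale by simp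
  qed
qed

end
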